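(* Let $a$, $b$ and $c$ be polynomials in $\mathbb{C}[z]$, not all constants, let $q\in\mathbb{C}\setminus\{0\}$ satisfy $|q|\neq1$, and let $n\in\mathbb{N}$ be such that $[a]_q^n$, $[b]_q^n$ and $[c]_q^n$ are relatively $q$-prime and satisfy $$[a]_q^n+[b]_q^n=[c]_q^n.$$ Then $n\leq 2$. In addition, if one of $a$, $b$ and $c$ is a constant, then $n=1$.
   Context: For a polynomial $P$, $[P]_q^n:=P(z)P(qz)\cdots P(q^{n-1}z)$. Separately, for $w\in\mathbb{C}$ the $q$-power of a linear factor is denoted $[z-w]_q^0=1$ and $[z-w]_q^k=(z-w)(z-wq)\cdots(z-wq^{k-1})$ for $k\ge 1$; this is the meaning of $[z-w]_q^k$ in the definition below. The $q$-derivative is $D_qf(z)=\frac{f(qz)-f(z)}{qz-z}$ for $z\neq 0$, and $D_qf(0)=f'(0)$; $D_q^0f=f$, $D_q^kf=D_q^{k-1}(D_qf)$. A point $z_0$ is a zero of $f$ with $q$-weight $k$ if $D_q^jf(z_0)=0$ for all $0\le j<k$, but $D_q^kf(z_0)\neq0$ (infinite $q$-weight if $D_q^jf(z_0)=0$ for all $j\ge0$). Common $q$-divisor: for entire $f,g$, the linear factor $z-z_0$ is a common $q$-divisor of $f$ and $g$ if there are a zero $z_1$ of $f$ with $q$-weight $k\geq 1$, a zero $z_2$ of $g$ with $q$-weight $l\geq 1$ ($q$-weights possibly infinite), integers $1\le k_1\le k$, $1\le l_1\le l$, and entire functions $F,G$ with $f(z)=[z-z_1]_q^{k_1}F(z)$,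 $g(z)=[z-z_2]_q^{l_1}G(z)$, such that $z_0\in\{z_1,z_2\}$ and $f(z)g(z)=[z-z_0]_q^{k_1+l_1}F(z)G(z)$. (If $z_0=z_1$ this means $z_2=q^{k_1}z_1$; if $z_0=z_2$ it means $z_1=q^{l_1}z_2$.) Two functions are relatively $q$-prime if they have no nonconstant common $q$-divisor; more than two functions are relatively $q$-prime if every pair of them is. *)

theory Defs
  imports
    "HOL-Complex_Analysis.Complex_Analysis"
    "HOL-Computational_Algebra.Polynomial"
    "HOL-Library.Extended_Nat"
begin

definition q_shift_prod :: "complex \<Rightarrow> complex poly \<Rightarrow> nat \<Rightarrow> complex \<Rightarrow> complex" where
  "q_shift_prod q P n = (\<lambda>z. \<Prod>i<n. poly P (q ^ i * z))"

text \<open>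
  The \<open>q\<close>-power \<open>[z - w]\<close> of a linear factor shifts the root \<open>w\<close>, not the
  variable; it differs from \<^term>\<open>q_shift_prod\<close> applied to the polynomial \<open>z - w\<close>.
\<close>

definition q_lin_power :: "complex \<Rightarrow> complex \<Rightarrow> nat \<Rightarrow> complex \<Rightarrow> complex" where
  "q_lin_power q w k = (\<lambda>z. \<Prod>i<k. (z - w * q ^ i))"

definition q_deriv :: "complex \<Rightarrow> (complex \<Rightarrow> complex) \<Rightarrow> complex \<Rightarrow> complex" where
  "q_deriv q f = (\<lambda>z. if z = 0 then deriv f 0 else (f (q * z) - f z) / (q * z - z))"

text \<open>
  For \<open>k = \<infinity>\<close> the second conjunct is vacuous and the first says that all iterated
  \<open>q\<close>-derivatives vanish. An actual zero is one with \<open>k \<ge> 1\<close>.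
\<close>

definition has_q_weight ::
  "complex \<Rightarrow> (complex \<Rightarrow> complex) \<Rightarrow> complex \<Rightarrow> enat \<Rightarrow> bool" where
  "has_q_weight q f z0 k \<longleftrightarrow>
     (\<forall>j. enat j < k \<longrightarrow> (q_deriv q ^^ j) f z0 = 0) \<and>
     (\<forall>m. k = enat m \<longrightarrow> (q_deriv q ^^ m) f z0 \<noteq> 0)"

text \<open>The number \<open>z0\<close> stands for the linear factor \<open>z - z0\<close>.\<close>

definition common_q_divisor ::
  "complex \<Rightarrow> (complex \<Rightarrow> complex) \<Rightarrow> (complex \<Rightarrow> complex) \<Rightarrow> complex \<Rightarrow> bool" where
  "common_q_divisor q f g z0 \<longleftrightarrow>
     (\<exists>z1 z2 (k :: enat) (l :: enat) (k1 :: nat) (l1 :: nat) F G.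
        has_q_weight q f z1 k \<and> 1 \<le> k \<and>
        has_q_weight q g z2 l \<and> 1 \<le> l \<and>
        1 \<le> k1 \<and> enat k1 \<le> k \<and> 1 \<le> l1 \<and> enat l1 \<le> l \<and>
        F holomorphic_on UNIV \<and> G holomorphic_on UNIV \<and>
        (\<forall>z. f z = q_lin_power q z1 k1 z * F z) \<and>
        (\<forall>z. g z = q_lin_power q z2 l1 z * G z) \<and>
        z0 \<in> {z1, z2} \<and>
        (\<forall>z. f z * g z = q_lin_power q z0 (k1 + l1) z * F z * G z))"

text \<open>
  Every common \<open>q\<close>-divisor is a linear factor, hence nonconstant. A list rather than a set
  is used, so that equal functions at different positions are also compared; the relation
  is symmetric in \<open>f\<close> and \<open>g\<close>, so \<open>i < j\<close> covers every pair.
\<close>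

definition relatively_q_prime :: "complex \<Rightarrow> (complex \<Rightarrow> complex) list \<Rightarrow> bool" where
  "relatively_q_prime q fs \<longleftrightarrow>
     (\<forall>i j. i < j \<and> j < length fs \<longrightarrow> \<not> (\<exists>z0. common_q_divisor q (fs ! i) (fs ! j) z0))"

end

theory Submission
  imports Defs "HOL-Computational_Algebra.Field_as_Ring"
    "HOL-Computational_Algebra.Polynomial_Factorial"
    "HOL-Computational_Algebra.Fundamental_Theorem_Algebra"
begin

text \<open>
  The argument is a multiplicative analogue of the proof of the polynomial Fermat theorem by
  Mason and Stothers, with the Casorati determinant \<open>W = f(z) g(qz) - f(qz) g(z)\<close> of
  \<open>f = [a]\<close> and \<open>g = [b]\<close> in place of the Wronskian. Put \<open>h = [c]\<close> and write
  \<open>\<alpha>, \<beta>, \<gamma>\<close> for the degrees of \<open>a, b, c\<close>.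

  The functions \<open>f(z)\<close> and \<open>f(qz)\<close> share the factor \<open>A = a(qz) \<cdots> a(q^(n-1) z)\<close>, which
  replaces the repeated factor of an ordinary \<open>n\<close>-th power; \<open>B\<close> and \<open>C\<close> are formed in the same
  way. Hence \<open>A B\<close> divides \<open>W\<close>, and so does \<open>C\<close>, because \<open>W\<close> is the same up to sign for
  any two of \<open>f, g, h\<close>. In addition \<open>W\<close> vanishes at the origin, and this zero comes on top of
  those of \<open>A\<close> and \<open>B\<close>. For \<open>n \<ge> 2\<close>, relative \<open>q\<close>-primeness implies that \<open>f, g, h\<close> are
  pairwise coprime (\<open>coprime_if_no_common_q_divisor\<close>), so that \<open>z A B C\<close> divides \<open>W\<close>
  (\<open>degree_q_casorati_ge\<close>). Since \<open>q\<close> is not a root of unity, \<open>W\<close> is nonzero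
  (\<open>q_casorati_eq_0_imp_constant\<close>). Comparing degrees,
  \<open>1 + (n-1)(\<alpha>+\<beta>+\<gamma>) \<le> n(\<alpha>+\<beta>)\<close>, that is \<open>(n-1)\<gamma> + 1 \<le> \<alpha>+\<beta>\<close>, together with the two
  permuted inequalities. Adding the three gives \<open>n \<le> 2\<close>. If \<open>n = 2\<close> and, say, \<open>\<alpha> = 0\<close>, they
  contain \<open>\<gamma> < \<beta>\<close> and \<open>\<beta> < \<gamma>\<close>, which is absurd.
\<close>

section \<open>Dilations of polynomials\<close>

definition q_dilate :: "complex \<Rightarrow> complex poly \<Rightarrow> complex poly" where
  "q_dilate q p = pcompose p [:0, q:]"

text \<open>
  The index set is arbitrary because the factor \<open>A\<close> common to \<open>[P](z)\<close> and \<open>[P](qz)\<close> is the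
  product over \<open>{1..<n}\<close>, whereas \<open>[P]\<close> itself is the one over \<open>{..<n}\<close>.
\<close>

definition dilation_prod :: "complex \<Rightarrow> complex poly \<Rightarrow> nat set \<Rightarrow> complex poly" where
  "dilation_prod q p I = (\<Prod>i\<in>I. q_dilate (q ^ i) p)"

text \<open>
  The Casorati determinant of \<open>f\<close> and \<open>g\<close>. Up to the factor \<open>(q - 1) z\<close> it is their Wronskian
  with respect to the \<open>q\<close>-derivative.
\<close>

definition q_casorati :: "complex \<Rightarrow> complex poly \<Rightarrow> complex poly \<Rightarrow> complex poly" where
  "q_casorati q f g = f * q_dilate q g - q_dilate q f * g"

lemma poly_q_dilate: "poly (q_dilate q p) z = poly p (q * z)"
  by (simp add: q_dilate_def poly_pcompose mult.commute)

lemma coeff_q_dilate: "coeff (q_dilate q p) i = q ^ i * coeff p i"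
  by (simp add: q_dilate_def coeff_pcompose_linear)

lemma degree_q_dilate: "q \<noteq> 0 \<Longrightarrow> degree (q_dilate q p) = degree p"
  by (simp add: q_dilate_def degree_pcompose)

lemma q_dilate_eq_0_iff: "q \<noteq> 0 \<Longrightarrow> q_dilate q p = 0 \<longleftrightarrow> p = 0"
  by (simp add: poly_eq_iff coeff_q_dilate)

lemma q_dilate_add: "q_dilate q (f + g) = q_dilate q f + q_dilate q g"
  by (simp add: q_dilate_def pcompose_add)

lemma poly_dilation_prod:
  "poly (dilation_prod q p {..<n}) = q_shift_prod q p n"
  by (rule ext) (simp add: dilation_prod_def q_shift_prod_def poly_prod poly_q_dilate)

lemma degree_dilation_prod:
  assumes "q \<noteq> 0" "finite I"
  shows "degree (dilation_prod q p I) = card I * degree p"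
proof (cases "p = 0")
  case True
  then show ?thesis
    by (cases "I = {}") (use assms in \<open>simp_all add: dilation_prod_def q_dilate_def power_0_left\<close>)
next
  case False
  then have "degree (dilation_prod q p I) = (\<Sum>i\<in>I. degree (q_dilate (q ^ i) p))"
    unfolding dilation_prod_def
    by (intro degree_prod_eq_sum_degree) (simp add: q_dilate_eq_0_iff assms)
  then show ?thesis
    by (simp add: degree_q_dilate assms)
qed

lemma dilation_prod_split:
  assumes "1 \<le> n"
  shows "dilation_prod q p {..<n} = p * dilation_prod q p {1..<n}"
proof -
  have "{..<n} = insert 0 {1..<n}"
    using assms by auto
  then show ?thesis
    by (simp add: dilation_prod_def) (simp add: q_dilate_def)
qed

lemma q_dilate_dilation_prod:
  assumes "1 \<le> n"
  shows "q_dilate q (dilation_prod q p {..<n}) = q_dilate (q ^ n) p * dilation_prod q p {1..<n}"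
proof -
  have "q_dilate q (dilation_prod q p {..<n}) = (\<Prod>i<n. q_dilate (q ^ Suc i) p)"
    by (simp add: dilation_prod_def q_dilate_def pcompose_prod flip: pcompose_assoc)
       (simp add: pcompose_pCons mult.commute)
  also have "\<dots> = (\<Prod>i\<in>{1..<Suc n}. q_dilate (q ^ i) p)"
    by (rule prod.reindex_bij_witness[of _ "\<lambda>i. i - 1" Suc]) auto
  also have "{1..<Suc n} = insert n {1..<n}"
    using assms by auto
  finally show ?thesis
    by (simp add: dilation_prod_def)
qed

text \<open>
  The difference is \<open>p(q^n z) - p(z)\<close> times the factor that \<open>[p](z)\<close> and \<open>[p](qz)\<close> have in common,
  and \<open>p(q^n z) - p(z)\<close> vanishes at the origin. The factor \<open>z\<close> is thus obtained in addition to any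
  power of \<open>z\<close> contained in the common factor, so that \<open>p(0) = 0\<close> is no special case.
\<close>

lemma dilation_prod_difference:
  assumes "1 \<le> n"
  obtains U where "q_dilate q (dilation_prod q p {..<n}) - dilation_prod q p {..<n}
                     = [:0, 1:] * dilation_prod q p {1..<n} * U"
proof -
  have "poly (q_dilate (q ^ n) p - p) 0 = 0"
    by (simp add: poly_q_dilate)
  then obtain U where "q_dilate (q ^ n) p - p = [:0, 1:] * U"
    by (metis dvdE minus_zero poly_eq_0_iff_dvd)
  then have "q_dilate q (dilation_prod q p {..<n}) - dilation_prod q p {..<n}
               = [:0, 1:] * dilation_prod q p {1..<n} * U"
    unfolding q_dilate_dilation_prod[OF assms] unfolding dilation_prod_split[OF assms]
    by (metis (no_types, lifting) left_diff_distrib mult.assoc mult.commute)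
  then show ?thesis by (rule that)
qed

section \<open>The Casorati determinant\<close>

text \<open>
  Written with the differences \<open>f(qz) - f(z)\<close> and \<open>g(qz) - g(z)\<close> instead of \<open>f(qz)\<close> and \<open>g(qz)\<close>,
  each of the two products in the determinant contains \<open>z\<close>, the common factor of \<open>a\<close> and that of \<open>b\<close>:
  one of the latter two comes from a difference and the other from \<open>f\<close> or \<open>g\<close> itself.
\<close>

lemma q_casorati_factor:
  assumes "1 \<le> n"
  obtains R where "q_casorati q (dilation_prod q a {..<n}) (dilation_prod q b {..<n})
     = [:0, 1:] * dilation_prod q a {1..<n} * (dilation_prod q b {1..<n} * R)"
proof -
  obtain U where U: "q_dilate q (dilation_prod q a {..<n}) - dilation_prod q a {..<n}
                     = [:0, 1:] * dilation_prod q a {1..<n} * U"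
    using dilation_prod_difference[OF assms] by blast
  obtain V where V: "q_dilate q (dilation_prod q b {..<n}) - dilation_prod q b {..<n}
                     = [:0, 1:] * dilation_prod q b {1..<n} * V"
    using dilation_prod_difference[OF assms] by blast
  let ?f = "dilation_prod q a {..<n}" and ?g = "dilation_prod q b {..<n}"
  have "q_casorati q ?f ?g = ?f * (q_dilate q ?g - ?g) - (q_dilate q ?f - ?f) * ?g"
    by (simp add: q_casorati_def algebra_simps)
  also have "\<dots> = [:0, 1:] * dilation_prod q a {1..<n} * (dilation_prod q b {1..<n} * (a * V - b * U))"
    unfolding U V unfolding dilation_prod_split[OF assms]
    by (simp add: algebra_simps del: mult_pCons_left mult_pCons_right)
  finally show ?thesis by (rule that)
qed

lemma q_casorati_add_right: "q_casorati q f (f + g) = q_casorati q f g"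
  by (simp add: q_casorati_def q_dilate_add algebra_simps)

lemma q_casorati_add_left: "q_casorati q (f + g) g = q_casorati q f g"
  by (simp add: q_casorati_def q_dilate_add algebra_simps)

lemma degree_q_casorati_le:
  assumes "q \<noteq> 0"
  shows "degree (q_casorati q f g) \<le> degree f + degree g"
  unfolding q_casorati_def
  by (intro degree_diff_le order.trans[OF degree_mult_le]) (simp_all add: degree_q_dilate assms)

lemma power_eq_imp_exponent_eq:
  fixes q :: complex
  assumes "q \<noteq> 0" "norm q \<noteq> 1" "q ^ i = q ^ j"
  shows "i = j"
proof -
  have "norm q ^ i = norm q ^ j"
    by (metis assms(3) norm_power)
  moreover have "norm q > 0" using assms(1) by simp
  ultimately show ?thesis
    using assms(2) by (metis linorder_neqE_linordered_idom power_inject_exp power_inject_exp')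
qed

text \<open>
  If the determinant vanishes, coprimality forces \<open>f(z)\<close> to divide \<open>f(qz)\<close>, and by degrees
  \<open>f(qz) = s f(z)\<close> and \<open>g(qz) = s g(z)\<close> with one constant \<open>s\<close>. Comparison of coefficients gives
  \<open>s = q ^ degree f = q ^ degree g\<close>. As the powers of \<open>q\<close> are distinct, a positive degree would make
  \<open>s \<noteq> 1\<close>, hence both constant terms zero, against coprimality.
\<close>

lemma q_casorati_eq_0_imp_constant:
  assumes q: "q \<noteq> 0" "norm q \<noteq> 1" and cop: "coprime f g" and W: "q_casorati q f g = 0"
  shows "degree f = 0 \<and> degree g = 0"
proof -
  from W have eq: "f * q_dilate q g = q_dilate q f * g"
    by (simp add: q_casorati_def)
  show ?thesis
  proof (cases "f = 0 \<or> g = 0")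
    case True
    then show ?thesis
      using cop by (auto elim!: is_unit_polyE)
  next
    case False
    have "f dvd q_dilate q f * g"
      by (simp flip: eq)
    then have "f dvd q_dilate q f"
      using cop by (simp add: coprime_dvd_mult_left_iff)
    then obtain k where k: "q_dilate q f = f * k" by (rule dvdE)
    have "k \<noteq> 0"
      using k False q(1) q_dilate_eq_0_iff[of q f] by auto
    then have "degree k = 0"
      using arg_cong[OF k, of degree] False by (simp add: degree_mult_eq degree_q_dilate q(1))
    then obtain s where s: "k = [:s:]" by (rule degree_eq_zeroE)
    have f: "q_dilate q f = smult s f"
      by (simp add: k s)
    have "f * q_dilate q g = f * smult s g"
      by (simp add: eq f)
    then have g: "q_dilate q g = smult s g"
      using False by (metis mult_left_cancel)
    have coeff_f: "q ^ i * coeff f i = s * coeff f i" for i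
      using arg_cong[OF f, of "\<lambda>p. coeff p i"] by (simp add: coeff_q_dilate)
    have coeff_g: "q ^ i * coeff g i = s * coeff g i" for i
      using arg_cong[OF g, of "\<lambda>p. coeff p i"] by (simp add: coeff_q_dilate)
    have s_f: "s = q ^ degree f" and s_g: "s = q ^ degree g"
      using coeff_f[of "degree f"] coeff_g[of "degree g"] False by simp_all
    then have same: "degree f = degree g"
      using power_eq_imp_exponent_eq[OF q] by metis
    have "degree f = 0"
    proof (rule ccontr)
      assume "degree f \<noteq> 0"
      then have "s \<noteq> 1"
        using power_eq_imp_exponent_eq[OF q, of "degree f" 0] s_f by auto
      then have "coeff f 0 = 0" "coeff g 0 = 0"
        using coeff_f[of 0] coeff_g[of 0] by simp_all
      then have "[:0, 1:] dvd f" "[:0, 1:] dvd g"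
        by (simp_all add: dvd_iff_poly_eq_0 poly_0_coeff_0)
      then have "is_unit [:0, 1 :: complex:]"
        using cop by (meson coprime_common_divisor)
      then show False
        by (simp add: is_unit_iff_degree)
    qed
    then show ?thesis
      by (simp add: same)
  qed
qed

text \<open>
  The analogue of the theorem of Mason and Stothers. Expressed through \<open>a\<close> and \<open>b\<close>, the determinant is
  \<open>z A B R\<close>; expressed through \<open>a\<close> and \<open>c\<close>, it is \<open>z A C S\<close>. Cancelling \<open>z A\<close> leaves
  \<open>B R = C S\<close>, and coprimality of \<open>B\<close> and \<open>C\<close> makes \<open>C\<close> a divisor of \<open>R\<close>. The bound is the degree
  of the divisor \<open>z A B C\<close> of the determinant.
\<close>

lemma degree_q_casorati_ge:
  assumes q: "q \<noteq> 0" and n: "1 \<le> n"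
    and sum: "dilation_prod q a {..<n} + dilation_prod q b {..<n} = dilation_prod q c {..<n}"
    and cop: "coprime (dilation_prod q b {..<n}) (dilation_prod q c {..<n})"
    and W: "q_casorati q (dilation_prod q a {..<n}) (dilation_prod q b {..<n}) \<noteq> 0"
  shows "1 + (n - 1) * (degree a + degree b + degree c)
           \<le> degree (q_casorati q (dilation_prod q a {..<n}) (dilation_prod q b {..<n}))"
proof -
  let ?f = "dilation_prod q a {..<n}" and ?g = "dilation_prod q b {..<n}"
    and ?h = "dilation_prod q c {..<n}"
  let ?A = "dilation_prod q a {1..<n}" and ?B = "dilation_prod q b {1..<n}"
    and ?C = "dilation_prod q c {1..<n}"
  obtain R where R: "q_casorati q ?f ?g = [:0, 1:] * ?A * (?B * R)"
    using q_casorati_factor[OF n] by blast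
  obtain S where S: "q_casorati q ?f ?h = [:0, 1:] * ?A * (?C * S)"
    using q_casorati_factor[OF n] by blast
  have "q_casorati q ?f ?g = q_casorati q ?f ?h"
    by (simp add: q_casorati_add_right flip: sum)
  then have eq: "[:0, 1:] * ?A * (?B * R) = [:0, 1:] * ?A * (?C * S)"
    by (simp only: R S)
  have nz: "[:0, 1:] * ?A \<noteq> 0" "?B * R \<noteq> 0"
    using W unfolding R by (metis mult_eq_0_iff)+
  have "?B * R = ?C * S"
    using eq nz(1) by (metis mult_left_cancel)
  then have "?C dvd ?B * R"
    by simp
  moreover have "coprime ?C ?B"
    using cop by (simp add: dilation_prod_split[OF n] coprime_commute)
  ultimately have "?C dvd R"
    by (simp add: coprime_dvd_mult_right_iff)
  then obtain T where T: "R = ?C * T" by (rule dvdE)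
  from W have fac: "?A \<noteq> 0" "?B \<noteq> 0" "?C \<noteq> 0" "T \<noteq> 0"
    unfolding R T by auto
  have "degree (q_casorati q ?f ?g) = 1 + degree ?A + degree ?B + degree ?C + degree T"
    unfolding R T using fac by (simp add: degree_mult_eq del: mult_pCons_left mult_pCons_right)
  then show ?thesis
    by (simp add: degree_dilation_prod q algebra_simps)
qed

section \<open>Common q-divisors and coprimality\<close>

lemma coprime_if_no_common_root:
  fixes f g :: "complex poly"
  assumes "\<And>x. poly f x = 0 \<Longrightarrow> poly g x = 0 \<Longrightarrow> False"
  shows "coprime f g"
proof (rule coprimeI)
  fix d assume d: "d dvd f" "d dvd g"
  have "degree d = 0"
  proof (rule ccontr)
    assume "degree d \<noteq> 0"
    then obtain x where "poly d x = 0"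
      using alg_closed_imp_poly_has_root[of d] by blast
    with d assms[of x] show False
      by (auto simp: dvd_def)
  qed
  moreover have "d \<noteq> 0"
    using d assms[of 0] by auto
  ultimately show "is_unit d"
    by (simp add: is_unit_iff_degree)
qed

lemma ex_q_weight_ge_1:
  assumes "f x = 0"
  shows "\<exists>k. has_q_weight q f x k \<and> 1 \<le> k"
proof (cases "\<forall>j. (q_deriv q ^^ j) f x = 0")
  case True
  then show ?thesis
    by (intro exI[of _ \<infinity>]) (simp add: has_q_weight_def)
next
  case False
  define m where "m = (LEAST j. (q_deriv q ^^ j) f x \<noteq> 0)"
  have m: "(q_deriv q ^^ m) f x \<noteq> 0"
    using False unfolding m_def by (metis (mono_tags, lifting) LeastI)
  have below: "(q_deriv q ^^ j) f x = 0" if "j < m" for j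
    using not_less_Least[of j] that unfolding m_def by blast
  have "m \<noteq> 0"
    using m assms by (cases m) auto
  then have "1 \<le> enat m"
    by (simp add: one_enat_def)
  then show ?thesis
    using m below by (intro exI[of _ "enat m"]) (simp add: has_q_weight_def)
qed

text \<open>
  Taking one linear factor \<open>z - x\<close> out of \<open>f\<close> and one, \<open>z - qx\<close>, out of \<open>g\<close> yields the \<open>q\<close>-power
  of order two at \<open>x\<close>. For \<open>x = 0\<close> this covers a common zero at the origin.
\<close>

lemma common_q_divisorI:
  assumes f: "poly f x = 0" and g: "poly g (q * x) = 0"
  shows "common_q_divisor q (poly f) (poly g) x" "common_q_divisor q (poly g) (poly f) x"
proof -
  obtain F where F: "f = [:- x, 1:] * F"
    using f by (metis dvdE poly_eq_0_iff_dvd)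
  obtain G where G: "g = [:- (q * x), 1:] * G"
    using g by (metis dvdE poly_eq_0_iff_dvd)
  obtain k l where k: "has_q_weight q (poly f) x k" "1 \<le> k"
    and l: "has_q_weight q (poly g) (q * x) l" "1 \<le> l"
    using ex_q_weight_ge_1[of "poly f" x q, OF f] ex_q_weight_ge_1[of "poly g" "q * x" q, OF g] by blast
  have lin: "q_lin_power q w 1 z = z - w"
    "q_lin_power q w 2 z = (z - w) * (z - q * w)" for w z
    by (simp_all add: q_lin_power_def numeral_2_eq_2 mult.commute)
  have factored: "poly f z = (z - x) * poly F z" "poly g z = (z - q * x) * poly G z" for z
    by (simp_all add: F G algebra_simps)
  have hol: "poly F holomorphic_on UNIV" "poly G holomorphic_on UNIV"
    by (intro holomorphic_intros)+
  show "common_q_divisor q (poly f) (poly g) x"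
    unfolding common_q_divisor_def
    by (rule exI[of _ x], rule exI[of _ "q * x"], rule exI[of _ k], rule exI[of _ l],
        rule exI[of _ 1], rule exI[of _ 1], rule exI[of _ "poly F"],
        rule exI[of _ "poly G"])
       (use k l hol in \<open>simp add: lin factored del: One_nat_def flip: one_enat_def\<close>)
  show "common_q_divisor q (poly g) (poly f) x"
    unfolding common_q_divisor_def
    by (rule exI[of _ "q * x"], rule exI[of _ x], rule exI[of _ l], rule exI[of _ k],
        rule exI[of _ 1], rule exI[of _ 1], rule exI[of _ "poly G"],
        rule exI[of _ "poly F"])
       (use k l hol in \<open>simp add: lin factored del: One_nat_def flip: one_enat_def\<close>)
qed

text \<open>
  Relative \<open>q\<close>-primeness alone excludes that a zero of one function is \<open>q\<close> times a zero of the other,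
  but not that they share a zero. For \<open>n \<ge> 2\<close>, however, the zeros of \<open>[a]\<close> come in strings
  \<open>w, w/q, \<dots>, w/q^(n-1)\<close> of length at least two, so that a shared zero \<open>x\<close> has a neighbour \<open>qx\<close>
  or \<open>x/q\<close> that is a zero of \<open>[a]\<close> as well.
\<close>

lemma coprime_if_no_common_q_divisor:
  assumes q: "q \<noteq> 0" and n: "2 \<le> n"
    and prime: "\<not> (\<exists>z0. common_q_divisor q (q_shift_prod q a n) (q_shift_prod q b n) z0)"
  shows "coprime (dilation_prod q a {..<n}) (dilation_prod q b {..<n})"
proof (rule coprime_if_no_common_root)
  let ?f = "dilation_prod q a {..<n}" and ?g = "dilation_prod q b {..<n}"
  fix x assume x: "poly ?f x = 0" "poly ?g x = 0"
  from x(1) obtain i where i: "i < n" "poly a (q ^ i * x) = 0"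
    by (auto simp: poly_dilation_prod q_shift_prod_def)
  have root: "poly ?f y = 0" if "j < n" "poly a (q ^ j * y) = 0" for j y
    using that by (auto simp: poly_dilation_prod q_shift_prod_def)
  show False
  proof (cases i)
    case 0
    have "poly ?f (x / q) = 0"
      using i n q by (intro root[of 1]) (auto simp: 0)
    moreover have "poly ?g (q * (x / q)) = 0"
      using x q by simp
    ultimately show False
      using common_q_divisorI(1)[of ?f "x / q" ?g q] prime unfolding poly_dilation_prod by blast
  next
    case (Suc j)
    have "poly ?f (q * x) = 0"
      using i Suc by (intro root[of j]) (auto simp: algebra_simps)
    then show False
      using common_q_divisorI(2)[of ?g x ?f q] x(2) prime unfolding poly_dilation_prod by blast
  qed
qed

section \<open>The degree inequalities\<close>

lemma fermat_degree_bound: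
  fixes n x y z :: nat
  assumes n: "1 \<le> n"
    and xy: "1 + (n - 1) * (x + y + z) \<le> n * (x + y)"
    and xz: "1 + (n - 1) * (x + y + z) \<le> n * (x + z)"
    and yz: "1 + (n - 1) * (x + y + z) \<le> n * (y + z)"
  shows "n \<le> 2 \<and> (x = 0 \<or> y = 0 \<or> z = 0 \<longrightarrow> n = 1)"
proof -
  obtain m where m: "n = Suc m" using n by (cases n) auto
  have *: "1 + m * z \<le> x + y" "1 + m * y \<le> x + z" "1 + m * x \<le> y + z"
    using xy xz yz by (simp_all add: m algebra_simps)
  have "m < 2"
  proof (rule ccontr)
    assume "\<not> m < 2"
    then have "2 * x \<le> m * x" "2 * y \<le> m * y" "2 * z \<le> m * z" by simp_all
    with * show False by linarith
  qed
  then consider "m = 0" | "m = 1" by linarith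
  then show ?thesis
    by cases (use * m in auto)
qed

theorem theorem5p1:
  fixes a b c :: "complex poly" and q :: complex and n :: nat
  assumes "\<not> (degree a = 0 \<and> degree b = 0 \<and> degree c = 0)"
    and "q \<noteq> 0" and "norm q \<noteq> 1"
    and "relatively_q_prime q [q_shift_prod q a n, q_shift_prod q b n, q_shift_prod q c n]"
    and "\<forall>z. q_shift_prod q a n z + q_shift_prod q b n z = q_shift_prod q c n z"
  shows "n \<le> 2 \<and> (degree a = 0 \<or> degree b = 0 \<or> degree c = 0 \<longrightarrow> n = 1)"
proof -
  let ?f = "dilation_prod q a {..<n}" and ?g = "dilation_prod q b {..<n}"
    and ?h = "dilation_prod q c {..<n}"
  \<comment> \<open>For \<open>n = 0\<close> the equation would read \<open>1 + 1 = 1\<close>.\<close>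
  have "n \<noteq> 0"
    using assms(5) by (intro notI) (simp add: q_shift_prod_def)
  moreover have ?thesis if n: "2 \<le> n"
  proof -
    have n1: "1 \<le> n" using n by simp
    have sum: "?f + ?g = ?h"
      using assms(5) by (simp add: poly_eq_poly_eq_iff[symmetric] fun_eq_iff poly_dilation_prod)
    have pair: "\<not> (\<exists>z0. common_q_divisor q ([q_shift_prod q a n, q_shift_prod q b n, q_shift_prod q c n] ! i)
                     ([q_shift_prod q a n, q_shift_prod q b n, q_shift_prod q c n] ! j) z0)"
      if "i < j" "j < 3" for i j
      using assms(4) that unfolding relatively_q_prime_def by simp
    have fg: "coprime ?f ?g"
      using pair[of 0 1] by (intro coprime_if_no_common_q_divisor assms(2) n) simp
    have gh: "coprime ?g ?h"
      using pair[of 1 2] by (intro coprime_if_no_common_q_divisor assms(2) n) simp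
    let ?W = "q_casorati q ?f ?g"
    have deg: "degree ?f = n * degree a" "degree ?g = n * degree b" "degree ?h = n * degree c"
      by (simp_all add: degree_dilation_prod assms(2))
    have "?W \<noteq> 0"
    proof
      assume "?W = 0"
      then have "degree ?f = 0 \<and> degree ?g = 0"
        using q_casorati_eq_0_imp_constant[OF assms(2,3) fg] by blast
      moreover from this have "degree ?h = 0"
        using degree_add_le_max[of ?f ?g] by (simp add: sum)
      ultimately show False
        using assms(1) n by (simp add: deg)
    qed
    then have lower: "1 + (n - 1) * (degree a + degree b + degree c) \<le> degree ?W"
      using degree_q_casorati_ge[OF assms(2) n1 sum gh] by blast
    have W_fh: "?W = q_casorati q ?f ?h" and W_hg: "?W = q_casorati q ?h ?g"
      by (simp_all add: q_casorati_add_right q_casorati_add_left flip: sum)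
    have "degree ?W \<le> n * (degree a + degree b)"
      using degree_q_casorati_le[OF assms(2), of ?f ?g] by (simp add: deg algebra_simps)
    moreover have "degree ?W \<le> n * (degree a + degree c)"
      using degree_q_casorati_le[OF assms(2), of ?f ?h] by (simp add: W_fh deg algebra_simps)
    moreover have "degree ?W \<le> n * (degree b + degree c)"
      using degree_q_casorati_le[OF assms(2), of ?h ?g] by (simp add: W_hg deg algebra_simps)
    ultimately show ?thesis
      by (intro fermat_degree_bound[OF n1]) (use lower in linarith)+
  qed
  ultimately show ?thesis
    by (cases "n = 1") auto
qed

end
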